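(* Let $k\ge1$ and $3\le N_1\le N_2\le\cdots\le N_{k+1}$. Then $$A_{k+1}(N_1,\dots,N_{k+1})\asymp_k H^{(k+1)}\left(N_1\cdots N_{k+1},\left(\frac{N_1}{2},\dots,\frac{N_k}{2}\right),(N_1,\dots,N_k)\right).$$
   Context: For real $N_1,\dots,N_{k+1}\ge1$, $A_{k+1}(N_1,\dots,N_{k+1})=|\{n_1\cdots n_{k+1}: n_i\in\mathbb{N},\ n_i\le N_i\ (1\le i\le k+1)\}|$, the number of distinct products. For $x\ge1$ and $\mathbf{y}=(y_1,\dots,y_k)$, $\mathbf{z}=(z_1,\dots,z_k)\in\mathbb{R}^k$, $H^{(k+1)}(x,\mathbf{y},\mathbf{z})$ is the number of positive integers $n\le x$ for which there exist positive integers $d_1,\dots,d_k$ with $d_1\cdots d_k\mid n$ and $y_i<d_i\le z_i$ for $1\le i\le k$. The notation $f\asymp_k g$ means $g\ll_k f\ll_k g$, with implied constants depending only on $k$. *)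

theory Defs
  imports Complex_Main
begin

definition prodA :: "nat \<Rightarrow> (nat \<Rightarrow> real) \<Rightarrow> nat" where
  "prodA m N = card {(\<Prod>i<m. n i) | n :: nat \<Rightarrow> nat. \<forall>i<m. 1 \<le> n i \<and> real (n i) \<le> N i}"

text \<open>H^{(k+1)}(x, y, z) with y, z vectors of length k (indices 0..k-1): number of
  positive integers n \<le> x having positive integers d_0..d_{k-1} with
  d_0 * ... * d_{k-1} dividing n and y_i < d_i \<le> z_i.\<close>
definition Hcount :: "nat \<Rightarrow> real \<Rightarrow> (nat \<Rightarrow> real) \<Rightarrow> (nat \<Rightarrow> real) \<Rightarrow> nat" where
  "Hcount k x y z = card {n :: nat. 1 \<le> n \<and> real n \<le> x \<and>
     (\<exists>d :: nat \<Rightarrow> nat. (\<Prod>i<k. d i) dvd n \<and>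
        (\<forall>i<k. 0 < d i \<and> y i < real (d i) \<and> real (d i) \<le> z i))}"

end

theory Submission
  imports Defs "HOL-Number_Theory.Prime_Powers" "HOL-Real_Asymp.Real_Asymp" "HOL-Library.FuncSet"
begin

text \<open>
  Write \<open>a(N)\<close> for the number of products from the box \<open>n i \<le> N i\<close>. Two comparisons of \<open>a\<close> on
  different boxes suffice; both weight the integers by \<open>ln n = (\<Sum>q | q dvd n. \<Lambda> q)\<close> and use only
  Chebyshev's bounds \<open>\<psi>(x) \<asymp> x\<close>.

  Lower bound: an integer counted by \<open>H\<close> is a product from the box whose longest side \<open>N k\<close> is
  lengthened by a constant factor. Lengthening the longest side costs a constant factor only: the
  weights of the last factors give sums of \<open>\<Lambda> q\<close> times \<open>a\<close> of the box with last side divided by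
  \<open>q\<close>, which are compared for the two boxes by \<open>\<psi>(c x) \<lesssim> \<psi>(x)\<close>.

  Upper bound: doubling each \<open>n i\<close> with \<open>i < k\<close> until it lies in \<open>(N i / 2, N i]\<close> maps products to
  integers counted by \<open>H\<close>. This is boundedly many to one except on products with some
  \<open>n i \<le> N i / 2 ^ R\<close>, so it is enough that dividing one side by \<open>z\<close> divides \<open>a\<close> by at least
  \<open>z / exp (sqrt (ln z))\<close> for all large \<open>z\<close>. This holds trivially when \<open>z\<close> exceeds all sides and is
  proved by downward induction on \<open>z\<close>: \<open>\<psi>(z)\<close> times the smaller count is at most the sum of
  \<open>ln (gcd n (fact z))\<close> over the products \<open>n\<close>, and by Rankin's trick the induction hypothesis makes
  \<open>ln (gcd n (fact z))\<close> larger than \<open>C * (ln z)\<^sup>2\<close> only on a negligible set.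
\<close>

section \<open>Chebyshev bounds\<close>

definition chebyshev_psi :: "nat \<Rightarrow> real" where
  "chebyshev_psi n = (\<Sum>q = 1..n. mangoldt q)"

lemma chebyshev_psi_mono: "m \<le> n \<Longrightarrow> chebyshev_psi m \<le> chebyshev_psi n"
  unfolding chebyshev_psi_def by (intro sum_mono2) (auto simp: mangoldt_nonneg)

lemma chebyshev_psi_nonneg: "chebyshev_psi n \<ge> 0"
  unfolding chebyshev_psi_def by (intro sum_nonneg) (auto simp: mangoldt_nonneg)

text \<open>From \<open>n\<close> to \<open>Suc n\<close> the quotient \<open>n div d\<close> grows
  by one exactly at the divisors \<open>d\<close> of \<open>Suc n\<close>, over which
  \<open>mangoldt\<close> sums to \<open>ln (Suc n)\<close>. The free upper limit \<open>M\<close>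
  lets \<open>fact n\<close> and \<open>fact (2 * n)\<close> be expanded over one range.\<close>

lemma ln_fact_eq_sum_mangoldt:
  assumes "n \<le> M"
  shows "ln (fact n) = (\<Sum>d = 1..M. mangoldt d * real (n div d))"
  using assms
proof (induction n)
  case 0
  then show ?case by simp
next
  case (Suc n)
  have "(\<Sum>d = 1..M. mangoldt d * real (Suc n div d)) =
        (\<Sum>d = 1..M. mangoldt d * real (n div d) + (if d dvd Suc n then mangoldt d else 0))"
    by (intro sum.cong refl) (auto simp: div_Suc dvd_eq_mod_eq_0 algebra_simps)
  also have "\<dots> = ln (fact n) + (\<Sum>d = 1..M. if d dvd Suc n then mangoldt d else 0)"
    using Suc by (simp add: sum.distrib)
  also have "(\<Sum>d = 1..M. if d dvd Suc n then mangoldt d else 0) =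
             (\<Sum>d | d dvd Suc n. mangoldt d :: real)"
    using Suc.prems
    by (intro sum.mono_neutral_cong_right)
       (auto intro!: Suc_leI Nat.gr0I intro: order_trans[OF dvd_imp_le])
  also have "\<dots> = ln (real (Suc n))"
    by (subst mangoldt_sum) auto
  also have "ln (fact n) + ln (real (Suc n)) = ln (fact (Suc n))"
    by (simp add: ln_mult add.commute del: of_nat_Suc)
  finally show ?case by simp
qed

lemma ln_central_binomial_eq:
  "ln (real ((2 * n) choose n)) =
   (\<Sum>d = 1..2*n. mangoldt d * (real (2 * n div d) - 2 * real (n div d)))"
proof -
  have "real ((2 * n) choose n) = fact (2 * n) / (fact n * fact n)"
    by (subst binomial_fact) auto
  hence "ln (real ((2 * n) choose n)) = ln (fact (2 * n)) - 2 * ln (fact n)"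
    by (simp add: ln_div ln_mult)
  thus ?thesis
    by (simp add: ln_fact_eq_sum_mangoldt[where M = "2 * n"] sum_subtractf sum_distrib_left
        algebra_simps)
qed

text \<open>These bounds make every coefficient in \<open>ln_central_binomial_eq\<close> equal to 0
  or 1.\<close>

lemma div_double_bounds:
  fixes n d :: nat
  assumes "d > 0"
  shows "2 * (n div d) \<le> 2 * n div d" "2 * n div d \<le> 2 * (n div d) + 1"
proof -
  have "d * (n div d) \<le> n" "n < d * (n div d) + d"
    using assms dividend_less_div_times[of d n] by (auto simp: algebra_simps)
  hence "(2 * (n div d)) * d \<le> 2 * n" "2 * n < (2 * (n div d) + 2) * d"
    by (auto simp: algebra_simps)
  thus "2 * (n div d) \<le> 2 * n div d" "2 * n div d \<le> 2 * (n div d) + 1"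
    using assms less_mult_imp_div_less[of "2 * n" "2 * (n div d) + 2" d]
    by (auto simp: less_eq_div_iff_mult_less_eq)
qed

lemma ln_central_binomial_le_psi: "ln (real ((2 * n) choose n)) \<le> chebyshev_psi (2 * n)"
  unfolding ln_central_binomial_eq chebyshev_psi_def
proof (intro sum_mono)
  fix d assume "d \<in> {1..2 * n}"
  hence "real (2 * n div d) - 2 * real (n div d) \<le> 1"
    using div_double_bounds(2)[of d n] by simp
  from mult_left_mono[OF this mangoldt_nonneg[of d]]
  show "mangoldt d * (real (2 * n div d) - 2 * real (n div d)) \<le> mangoldt d" by simp
qed

text \<open>The coefficients in \<open>ln_central_binomial_eq\<close> equal 1 for
  \<open>n < d \<le> 2 * n\<close> and are nonnegative elsewhere.\<close>

lemma psi_double_le: "chebyshev_psi (2 * n) \<le> chebyshev_psi n + ln (real ((2 * n) choose n))"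
proof -
  have "chebyshev_psi (2 * n) = chebyshev_psi n + (\<Sum>q = n+1..2*n. mangoldt q)"
    unfolding chebyshev_psi_def
    using sum.ub_add_nat[of 1 n "mangoldt :: nat \<Rightarrow> real" n] by (simp add: mult_2)
  also have "(\<Sum>q = n+1..2*n. mangoldt q) =
      (\<Sum>d = n+1..2*n. mangoldt d * (real (2 * n div d) - 2 * real (n div d)))"
  proof (intro sum.cong refl)
    fix d assume d: "d \<in> {n+1..2*n}"
    hence "2 * n div d = 1"
      by (intro div_nat_eqI) auto
    with d show "mangoldt d = mangoldt d * (real (2 * n div d) - 2 * real (n div d))" by simp
  qed
  also have "\<dots> \<le> ln (real ((2 * n) choose n))"
    unfolding ln_central_binomial_eq
  proof (intro sum_mono2)
    fix d assume "d \<in> {1..2*n} - {n+1..2*n}"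
    thus "0 \<le> mangoldt d * (real (2 * n div d) - 2 * real (n div d))"
      using div_double_bounds(1)[of d n] by (intro mult_nonneg_nonneg mangoldt_nonneg) auto
  qed auto
  finally show ?thesis by simp
qed

lemma two_power_le_central_binomial: "2 ^ n \<le> (2 * n) choose n"
proof (induction n)
  case (Suc n)
  have "2 * 2 ^ n \<le> 2 * ((2 * n) choose n)"
    using Suc by simp
  also have "(2 * n) choose n \<le> Suc (2 * n) choose n"
    by (cases n) auto
  also have "2 * (Suc (2 * n) choose n) = (Suc (2 * n) choose n) + (Suc (2 * n) choose Suc n)"
    using binomial_symmetric[of n "Suc (2 * n)"] by (simp add: mult_2)
  also have "\<dots> = (2 * Suc n) choose Suc n" by simp
  finally show ?case by simp
qed auto

lemma chebyshev_psi_lower: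
  assumes "n \<ge> 2"
  shows "real n / 6 \<le> chebyshev_psi n"
proof -
  \<comment> \<open>The constant 1/6 is the product of 1/3, from \<open>n \<le> 3 * m\<close>, and
    1/2, from \<open>ln 2 \<ge> 1 / 2\<close>.\<close>
  define m where "m = n div 2"
  have "n \<le> 3 * m" "2 * m \<le> n"
    using assms unfolding m_def by linarith+
  hence m: "real n \<le> 3 * real m" "2 * m \<le> n" by linarith+
  have ln2: "ln 2 \<ge> (1 / 2 :: real)"
    using ln_le_minus_one[of "1 / 2"] by (simp add: ln_div)
  have "real n / 6 \<le> real m * (1 / 2)" using m by simp
  also have "\<dots> \<le> real m * ln 2" using ln2 by (intro mult_left_mono) auto
  also have "\<dots> = ln (real (2 ^ m))" by (simp add: ln_realpow)
  also have "\<dots> \<le> ln (real ((2 * m) choose m))"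
    using two_power_le_central_binomial[of m]
    by (subst ln_le_cancel_iff) (auto simp flip: of_nat_power)
  also have "\<dots> \<le> chebyshev_psi (2 * m)" by (rule ln_central_binomial_le_psi)
  also have "\<dots> \<le> chebyshev_psi n" using m by (intro chebyshev_psi_mono)
  finally show ?thesis .
qed

lemma psi_double_le_linear: "chebyshev_psi (2 * n) \<le> chebyshev_psi n + 2 * real n"
proof -
  have "(2 * n) choose n \<le> 2 ^ (2 * n)"
    by (rule binomial_le_pow2)
  hence "real ((2 * n) choose n) \<le> 2 ^ (2 * n)"
    by (metis of_nat_le_iff of_nat_numeral of_nat_power)
  hence "ln (real ((2 * n) choose n)) \<le> ln (2 ^ (2 * n))"
    by (subst ln_le_cancel_iff) auto
  also have "\<dots> = 2 * real n * ln 2" by (simp add: ln_realpow)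
  also have "\<dots> \<le> 2 * real n * 1"
    using ln_2_less_1 by (intro mult_left_mono) auto
  finally show ?thesis using psi_double_le[of n] by simp
qed

lemma chebyshev_psi_upper: "chebyshev_psi n \<le> 4 * real n"
proof (induction n rule: less_induct)
  case (less n)
  show ?case
  proof (cases "n \<le> 1")
    case True
    hence "chebyshev_psi n = 0"
      by (cases n) (auto simp: chebyshev_psi_def)
    thus ?thesis by simp
  next
    case False
    \<comment> \<open>Rounding up keeps \<open>n \<le> 2 * m\<close>. The recursion yields
      \<open>6 * m\<close>, and \<open>3 * m \<le> 2 * n\<close> brings this back to
      \<open>4 * n\<close>.\<close>
    define m where "m = (n + 1) div 2"
    have m: "m < n" "n \<le> 2 * m" "3 * m \<le> 2 * n" using False by (auto simp: m_def)
    have "chebyshev_psi n \<le> chebyshev_psi (2 * m)" using m by (intro chebyshev_psi_mono)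
    also have "\<dots> \<le> 4 * real m + 2 * real m"
      using psi_double_le_linear[of m] less.IH[of m] m by simp
    also have "\<dots> \<le> 4 * real n" using m by linarith
    finally show ?thesis .
  qed
qed

section \<open>Products from a box\<close>

text \<open>Integer side lengths allow sides to be divided by \<open>div\<close>; a side that
  becomes 0 empties the set.\<close>

definition box_products :: "nat \<Rightarrow> (nat \<Rightarrow> nat) \<Rightarrow> nat set" where
  "box_products m N = {(\<Prod>i<m. n i) | n. \<forall>i<m. 1 \<le> n i \<and> n i \<le> N i}"

lemma box_productsI:
  "x = (\<Prod>i<m. n i) \<Longrightarrow> (\<And>i. i < m \<Longrightarrow> 1 \<le> n i \<and> n i \<le> N i) \<Longrightarrow> x \<in> box_products m N"
  unfolding box_products_def by blast

lemma box_productsE: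
  assumes "x \<in> box_products m N"
  obtains n where "x = (\<Prod>i<m. n i)" "\<And>i. i < m \<Longrightarrow> 1 \<le> n i" "\<And>i. i < m \<Longrightarrow> n i \<le> N i"
  using assms unfolding box_products_def by blast

lemma box_products_bounds:
  assumes "x \<in> box_products m N"
  shows "0 < x" "x \<le> (\<Prod>i<m. N i)"
proof -
  from assms obtain n where n: "x = (\<Prod>i<m. n i)" "\<And>i. i < m \<Longrightarrow> 1 \<le> n i"
    "\<And>i. i < m \<Longrightarrow> n i \<le> N i" by (elim box_productsE) blast
  show "0 < x" using n(2) unfolding n(1) by (intro prod_pos) force
  show "x \<le> (\<Prod>i<m. N i)" unfolding n(1) using n(3) by (intro prod_mono) auto
qed

lemma finite_box_products [simp, intro]: "finite (box_products m N)"
  by (rule finite_subset[of _ "{..\<Prod>i<m. N i}"]) (auto dest: box_products_bounds)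

lemma box_products_mono:
  assumes "\<And>i. i < m \<Longrightarrow> N i \<le> N' i"
  shows "box_products m N \<subseteq> box_products m N'"
  using assms by (auto elim!: box_productsE intro!: box_productsI intro: order_trans)

lemma box_products_cong:
  "(\<And>i. i < m \<Longrightarrow> N i = N' i) \<Longrightarrow> box_products m N = box_products m N'"
  by (intro equalityI box_products_mono) auto

lemma card_box_products_mono:
  "(\<And>i. i < m \<Longrightarrow> N i \<le> N' i) \<Longrightarrow> card (box_products m N) \<le> card (box_products m N')"
  by (intro card_mono box_products_mono) auto

lemma one_in_box_products: "(\<And>i. i < m \<Longrightarrow> 1 \<le> N i) \<Longrightarrow> 1 \<in> box_products m N"
  by (intro box_productsI[where n = "\<lambda>_. 1"]) auto

lemma prod_mult_in_box_products:
  assumes "x \<in> box_products m (\<lambda>i. N i div w i)" and "\<And>i. i < m \<Longrightarrow> 0 < w i"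
  shows "(\<Prod>i<m. w i) * x \<in> box_products m N"
proof -
  from assms(1) obtain n where n: "x = (\<Prod>i<m. n i)" "\<And>i. i < m \<Longrightarrow> 1 \<le> n i"
    "\<And>i. i < m \<Longrightarrow> n i \<le> N i div w i" by (elim box_productsE) blast
  show ?thesis
  proof (rule box_productsI)
    show "(\<Prod>i<m. w i) * x = (\<Prod>i<m. w i * n i)" by (simp add: n(1) prod.distrib)
    fix i assume i: "i < m"
    have "w i * n i \<le> w i * (N i div w i)" using n(3)[OF i] by simp
    also have "\<dots> \<le> N i" by simp
    finally show "1 \<le> w i * n i \<and> w i * n i \<le> N i"
      using n(2)[OF i] assms(2)[OF i] by (simp add: Suc_le_eq)
  qed
qed

lemma mult_in_box_products:
  assumes "x \<in> box_products m (N(i := N i div q))" and "i < m" "0 < q"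
  shows "q * x \<in> box_products m N"
proof -
  have "N(i := N i div q) = (\<lambda>j. N j div ((\<lambda>_. 1)(i := q)) j)" by auto
  hence "(\<Prod>j<m. ((\<lambda>_. 1)(i := q)) j) * x \<in> box_products m N"
    using assms by (intro prod_mult_in_box_products) auto
  also have "(\<Prod>j<m. ((\<lambda>_. 1)(i := q)) j) = q"
    using assms(2) by (simp add: fun_upd_def del: One_nat_def)
  finally show ?thesis .
qed

text \<open>By induction on \<open>m\<close>: a divisor of a product of two numbers is a product of
  divisors of the two.\<close>

lemma dvd_prod_split:
  fixes n :: "nat \<Rightarrow> nat"
  assumes "d dvd (\<Prod>i<m. n i)"
  shows "\<exists>w. d = (\<Prod>i<m. w i) \<and> (\<forall>i<m. w i dvd n i)"
  using assms
proof (induction m arbitrary: d)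
  case (Suc m)
  from Suc.prems have "d dvd (\<Prod>i<m. n i) * n m" by simp
  from division_decomp[OF this] obtain b c where
    bc: "d = b * c" "b dvd (\<Prod>i<m. n i)" "c dvd n m" by blast
  from Suc.IH[OF bc(2)] obtain w where w: "b = (\<Prod>i<m. w i)" "\<forall>i<m. w i dvd n i" by blast
  show ?case
    using bc w by (intro exI[of _ "w(m := c)"]) (auto simp: less_Suc_eq)
qed auto

text \<open>Distributing the divisor over the factors of one factorization of \<open>x\<close>
  leaves a cofactor in a box with smaller sides. This is how divisibility conditions turn into
  counts of smaller boxes.\<close>

lemma box_products_dvd_split:
  assumes "x \<in> box_products m N" "d dvd x"
  obtains w y where "d = (\<Prod>i<m. w i)" "x = d * y" "y \<in> box_products m (\<lambda>i. N i div w i)"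
    "\<And>i. i < m \<Longrightarrow> 0 < w i"
proof -
  from assms(1) obtain n where n: "x = (\<Prod>i<m. n i)" "\<And>i. i < m \<Longrightarrow> 1 \<le> n i"
    "\<And>i. i < m \<Longrightarrow> n i \<le> N i" by (elim box_productsE) blast
  from dvd_prod_split[of d n m] assms(2) n(1) obtain w where
    w: "d = (\<Prod>i<m. w i)" "\<And>i. i < m \<Longrightarrow> w i dvd n i" by auto
  have pos: "0 < w i" if "i < m" for i
    using w(2)[OF that] n(2)[OF that] by (auto intro!: Nat.gr0I)
  show ?thesis
  proof (rule that[OF w(1)])
    show "x = d * (\<Prod>i<m. n i div w i)"
      unfolding n(1) w(1) prod.distrib[symmetric] using w(2) by (intro prod.cong) auto
    show "(\<Prod>i<m. n i div w i) \<in> box_products m (\<lambda>i. N i div w i)"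
    proof (rule box_productsI[OF refl])
      fix i assume i: "i < m"
      have "w i \<le> n i" using w(2)[OF i] n(2)[OF i] by (intro dvd_imp_le) auto
      thus "1 \<le> n i div w i \<and> n i div w i \<le> N i div w i"
        using pos[OF i] n(3)[OF i] by (auto simp: div_le_mono Suc_le_eq div_greater_zero_iff)
    qed
  qed (use pos in auto)
qed

lemma card_box_products_div_le:
  assumes "i < m" "0 < q"
  shows "card (box_products m (N(i := N i div q))) \<le> card {n \<in> box_products m N. q dvd n}"
proof (rule card_inj_on_le)
  show "inj_on ((*) q) (box_products m (N(i := N i div q)))"
    using assms(2) by (auto simp: inj_on_def)
  show "(*) q ` box_products m (N(i := N i div q)) \<subseteq> {n \<in> box_products m N. q dvd n}"
    using assms by (auto intro: mult_in_box_products)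
qed auto

section \<open>Counting box products with von Mangoldt weights\<close>

text \<open>Expand \<open>ln (gcd n L)\<close> as the sum of \<open>mangoldt\<close> over the common
  divisors of \<open>n\<close> and \<open>L\<close>, then exchange the two sums.\<close>

lemma sum_ln_gcd:
  assumes "finite S" "0 \<notin> S" "0 < L"
  shows "(\<Sum>n\<in>S. ln (real (gcd n L))) =
         (\<Sum>q | q dvd L. mangoldt q * real (card {n \<in> S. q dvd n}))"
proof -
  have fin: "finite {q. q dvd L}" using assms(3) by simp
  have "(\<Sum>n\<in>S. ln (real (gcd n L))) =
        (\<Sum>n\<in>S. \<Sum>q | q dvd L. if q dvd n then mangoldt q else 0)"
  proof (intro sum.cong refl)
    fix n assume "n \<in> S"
    have "ln (real (gcd n L)) = (\<Sum>q | q dvd gcd n L. mangoldt q)"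
      using assms(3) by (subst mangoldt_sum) auto
    also have "\<dots> = (\<Sum>q | q dvd L. if q dvd n then mangoldt q else 0)"
      using fin by (intro sum.mono_neutral_cong_left) auto
    finally show "ln (real (gcd n L)) = (\<Sum>q | q dvd L. if q dvd n then mangoldt q else 0)" .
  qed
  also have "\<dots> = (\<Sum>q | q dvd L. \<Sum>n\<in>S. if q dvd n then mangoldt q else 0)"
    by (rule sum.swap)
  also have "\<dots> = (\<Sum>q | q dvd L. mangoldt q * real (card {n \<in> S. q dvd n}))"
    using assms(1) by (intro sum.cong refl) (simp add: sum.inter_filter[symmetric])
  finally show ?thesis .
qed

text \<open>Every \<open>q \<le> z\<close> divides \<open>fact z\<close>, and the remaining divisors
  of \<open>fact z\<close> only add nonnegative terms.\<close>

lemma sum_mangoldt_card_box_le: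
  assumes "i < m"
  shows "(\<Sum>q = 1..z. mangoldt q * real (card (box_products m (N(i := N i div q)))))
         \<le> (\<Sum>n\<in>box_products m N. ln (real (gcd n (fact z))))"
proof -
  have "(\<Sum>q = 1..z. mangoldt q * real (card (box_products m (N(i := N i div q)))))
     \<le> (\<Sum>q = 1..z. mangoldt q * real (card {n \<in> box_products m N. q dvd n}))"
    using assms
    by (intro sum_mono mult_left_mono mangoldt_nonneg)
       (auto intro!: card_box_products_div_le)
  also have "\<dots> \<le> (\<Sum>q | q dvd fact z. mangoldt q * real (card {n \<in> box_products m N. q dvd n}))"
    by (intro sum_mono2 mult_nonneg_nonneg mangoldt_nonneg) (auto intro: dvd_fact)
  also have "\<dots> = (\<Sum>n\<in>box_products m N. ln (real (gcd n (fact z))))"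
    by (subst sum_ln_gcd) (auto dest: box_products_bounds)
  finally show ?thesis .
qed

text \<open>For \<open>q \<le> z\<close> the box with side \<open>N i div z\<close> is contained in
  the one with side \<open>N i div q\<close>, so one count serves for all \<open>q\<close>.\<close>

lemma psi_mult_card_box_le:
  assumes "i < m"
  shows "chebyshev_psi z * real (card (box_products m (N(i := N i div z))))
         \<le> (\<Sum>n\<in>box_products m N. ln (real (gcd n (fact z))))"
proof -
  have "chebyshev_psi z * real (card (box_products m (N(i := N i div z)))) =
        (\<Sum>q = 1..z. mangoldt q * real (card (box_products m (N(i := N i div z)))))"
    by (simp add: chebyshev_psi_def sum_distrib_right)
  also have "\<dots> \<le> (\<Sum>q = 1..z. mangoldt q * real (card (box_products m (N(i := N i div q)))))"
    by (intro sum_mono mult_left_mono mangoldt_nonneg)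
       (auto intro!: card_box_products_mono div_le_mono2)
  also note sum_mangoldt_card_box_le[OF assms]
  finally show ?thesis .
qed

section \<open>Rankin's trick for products with a large smooth part\<close>

text \<open>The sides are divided one after the other. Division keeps them below \<open>B\<close>,
  so a one-side estimate \<open>h\<close> known only for boxes with sides at most \<open>B\<close>
  applies each time.\<close>

lemma card_box_products_div_vector_le:
  fixes h :: "nat \<Rightarrow> real"
  assumes h: "\<And>N i q. \<lbrakk>\<And>i. i < m \<Longrightarrow> N i \<le> B; i < m; 0 < q\<rbrakk> \<Longrightarrow>
      real (card (box_products m (N(i := N i div q)))) \<le> h q * real (card (box_products m N))"
    and h0: "\<And>q. 0 \<le> h q"
    and N: "\<And>i. i < m \<Longrightarrow> N i \<le> B" and w: "\<And>i. i < m \<Longrightarrow> 0 < w i"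
  shows "real (card (box_products m (\<lambda>i. N i div w i)))
         \<le> (\<Prod>i<m. h (w i)) * real (card (box_products m N))"
proof -
  have "real (card (box_products m (\<lambda>i. if i < j then N i div w i else N i)))
        \<le> (\<Prod>i<j. h (w i)) * real (card (box_products m N))" if "j \<le> m" for j
    using that
  proof (induction j)
    case (Suc j)
    let ?N = "\<lambda>i. if i < j then N i div w i else N i"
    have "(\<lambda>i. if i < Suc j then N i div w i else N i) = ?N(j := ?N j div w j)"
      by (auto simp: fun_eq_iff less_Suc_eq)
    hence "real (card (box_products m (\<lambda>i. if i < Suc j then N i div w i else N i))) =
           real (card (box_products m (?N(j := ?N j div w j))))" by (rule arg_cong)
    also have "real (card (box_products m (?N(j := ?N j div w j))))
        \<le> h (w j) * real (card (box_products m ?N))"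
    proof (rule h)
      fix i assume "i < m"
      thus "?N i \<le> B" using N[of i] by (auto intro: order_trans[OF div_le_dividend])
    qed (use Suc.prems w in auto)
    also have "\<dots> \<le> h (w j) * ((\<Prod>i<j. h (w i)) * real (card (box_products m N)))"
      by (rule mult_left_mono[OF Suc.IH h0]) (use Suc.prems in simp)
    finally show ?case by (simp add: mult_ac)
  qed auto
  from this[of m] have "real (card (box_products m (\<lambda>i. if i < m then N i div w i else N i)))
        \<le> (\<Prod>i<m. h (w i)) * real (card (box_products m N))" by simp
  also have "box_products m (\<lambda>i. if i < m then N i div w i else N i) =
             box_products m (\<lambda>i. N i div w i)"
    by (rule box_products_cong) auto
  finally show ?thesis .
qed

text \<open>Each such \<open>n\<close> is \<open>gcd n L\<close> times an element of a box with
  sides \<open>N i div w i\<close>, where the \<open>w i\<close> divide \<open>L\<close> and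
  multiply to the gcd. A union bound over \<open>w\<close>, weighted by Rankin's factor, splits into
  \<open>m\<close> equal sums.\<close>

lemma card_box_products_large_gcd_le:
  fixes h :: "nat \<Rightarrow> real"
  assumes h: "\<And>N i q. \<lbrakk>\<And>i. i < m \<Longrightarrow> N i \<le> B; i < m; 0 < q\<rbrakk> \<Longrightarrow>
      real (card (box_products m (N(i := N i div q)))) \<le> h q * real (card (box_products m N))"
    and h0: "\<And>q. 0 \<le> h q"
    and N: "\<And>i. i < m \<Longrightarrow> N i \<le> B" and L: "0 < L" and W: "0 < W" and \<delta>: "0 \<le> \<delta>"
  shows "real (card {n \<in> box_products m N. W < real (gcd n L)})
    \<le> W powr -\<delta> * (\<Sum>q | q dvd L. h q * real q powr \<delta>) ^ m * real (card (box_products m N))"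
proof -
  let ?D = "{q. q dvd L}"
  let ?P = "PiE {..<m} (\<lambda>_. ?D)"
  let ?Q = "{w \<in> ?P. W < real (\<Prod>i<m. w i)}"
  let ?a = "real (card (box_products m N))"
  have finD: "finite ?D" using L by simp
  have finP: "finite ?P" using finD by (intro finite_PiE) auto
  have pos: "0 < w i" if "w \<in> ?P" "i < m" for w i
    using that by (intro dvd_pos_nat[OF L]) auto
  have "{n \<in> box_products m N. W < real (gcd n L)} \<subseteq>
        (\<Union>w\<in>?Q. (*) (\<Prod>i<m. w i) ` box_products m (\<lambda>i. N i div w i))"
  proof
    fix x assume "x \<in> {n \<in> box_products m N. W < real (gcd n L)}"
    hence x: "x \<in> box_products m N" "W < real (gcd x L)" by auto
    from box_products_dvd_split[OF x(1) gcd_dvd1[of x L]] obtain w y where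
      w: "gcd x L = (\<Prod>i<m. w i)" "x = gcd x L * y" "y \<in> box_products m (\<lambda>i. N i div w i)"
      by metis
    \<comment> \<open>Membership in \<open>PiE\<close> fixes the values outside
      \<open>{..<m}\<close>, hence the restriction.\<close>
    define v where "v = restrict w {..<m}"
    have v: "v i = w i" if "i < m" for i using that by (simp add: v_def)
    have "w i dvd L" if "i < m" for i
    proof -
      have "w i dvd (\<Prod>i<m. w i)" using that by (intro dvd_prodI) auto
      also have "\<dots> dvd L" by (subst w(1)[symmetric]) simp
      finally show ?thesis .
    qed
    hence "v \<in> ?P" by (auto simp: v_def)
    moreover have prod: "(\<Prod>i<m. v i) = gcd x L"
      unfolding w(1) by (intro prod.cong) (auto simp: v)
    ultimately have "v \<in> ?Q" using x by (simp del: of_nat_prod)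
    moreover have "box_products m (\<lambda>i. N i div v i) = box_products m (\<lambda>i. N i div w i)"
      by (intro box_products_cong) (auto simp: v)
    ultimately show "x \<in> (\<Union>w\<in>?Q. (*) (\<Prod>i<m. w i) ` box_products m (\<lambda>i. N i div w i))"
      using w(2,3) prod by auto
  qed
  hence "card {n \<in> box_products m N. W < real (gcd n L)} \<le>
         card (\<Union>w\<in>?Q. (*) (\<Prod>i<m. w i) ` box_products m (\<lambda>i. N i div w i))"
    using finP by (intro card_mono) auto
  also have "\<dots> \<le> (\<Sum>w\<in>?Q. card ((*) (\<Prod>i<m. w i) ` box_products m (\<lambda>i. N i div w i)))"
    using finP by (intro card_UN_le) auto
  also have "\<dots> \<le> (\<Sum>w\<in>?Q. card (box_products m (\<lambda>i. N i div w i)))"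
    by (intro sum_mono card_image_le) auto
  finally have "real (card {n \<in> box_products m N. W < real (gcd n L)}) \<le>
      real (\<Sum>w\<in>?Q. card (box_products m (\<lambda>i. N i div w i)))"
    by (rule of_nat_mono)
  also have "\<dots> = (\<Sum>w\<in>?Q. real (card (box_products m (\<lambda>i. N i div w i))))"
    by (rule of_nat_sum)
  also have "\<dots> \<le> (\<Sum>w\<in>?Q. W powr -\<delta> * (\<Prod>i<m. h (w i) * real (w i) powr \<delta>) * ?a)"
  proof (intro sum_mono)
    fix w assume w: "w \<in> ?Q"
    have "1 \<le> (real (\<Prod>i<m. w i) / W) powr \<delta>"
      using w W \<delta> by (intro ge_one_powr_ge_zero) (auto simp: field_simps)
    also have "\<dots> = W powr -\<delta> * (\<Prod>i<m. real (w i)) powr \<delta>"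
      using W by (simp add: powr_divide powr_minus field_simps prod_nonneg)
    also have "(\<Prod>i<m. real (w i)) powr \<delta> = (\<Prod>i<m. real (w i) powr \<delta>)"
      by (rule prod_powr_distrib)
    finally have "1 \<le> W powr -\<delta> * (\<Prod>i<m. real (w i) powr \<delta>)" .
    hence "1 * ((\<Prod>i<m. h (w i)) * ?a) \<le>
        (W powr -\<delta> * (\<Prod>i<m. real (w i) powr \<delta>)) * ((\<Prod>i<m. h (w i)) * ?a)"
      by (intro mult_right_mono mult_nonneg_nonneg prod_nonneg) (auto simp: h0)
    moreover have "real (card (box_products m (\<lambda>i. N i div w i))) \<le> (\<Prod>i<m. h (w i)) * ?a"
    proof (rule card_box_products_div_vector_le[where B = B and N = N and w = w and h = h])
      show "0 < w i" if "i < m" for i using pos[of w i] w that by blast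
    qed (fact h h0 N)+
    ultimately show "real (card (box_products m (\<lambda>i. N i div w i)))
        \<le> W powr -\<delta> * (\<Prod>i<m. h (w i) * real (w i) powr \<delta>) * ?a"
      by (simp add: prod.distrib mult_ac)
  qed
  also have "\<dots> \<le> (\<Sum>w\<in>?P. W powr -\<delta> * (\<Prod>i<m. h (w i) * real (w i) powr \<delta>) * ?a)"
    using finP by (intro sum_mono2 mult_nonneg_nonneg prod_nonneg) (auto simp: h0)
  also have "\<dots> = W powr -\<delta> * (\<Sum>w\<in>?P. \<Prod>i<m. h (w i) * real (w i) powr \<delta>) * ?a"
    by (simp add: sum_distrib_left sum_distrib_right)
  also have "(\<Sum>w\<in>?P. \<Prod>i<m. h (w i) * real (w i) powr \<delta>) =
             (\<Prod>i<m. \<Sum>q\<in>?D. h q * real q powr \<delta>)"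
    using finD by (subst prod_sum_PiE) auto
  finally show ?thesis by simp
qed

section \<open>Shrinking one side of the box\<close>

text \<open>A finite Euler product bound for a completely multiplicative \<open>f\<close>. Each new
  prime \<open>p\<close> is split off with its full multiplicity, and its powers are bounded by the
  geometric series.\<close>

lemma sum_smooth_le_prod:
  fixes f :: "nat \<Rightarrow> real"
  assumes "finite P" "\<And>p. p \<in> P \<Longrightarrow> prime p"
    and f: "\<And>a b. f (a * b) = f a * f b" "f 1 = 1" "\<And>a. 0 \<le> f a"
      "\<And>p. p \<in> P \<Longrightarrow> f p < 1"
    and "finite X" "\<And>x. x \<in> X \<Longrightarrow> 0 < x \<and> prime_factors x \<subseteq> P"
  shows "sum f X \<le> (\<Prod>p\<in>P. 1 / (1 - f p))"
  using assms(1,2,6,7,8)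
proof (induction P arbitrary: X rule: finite_induct)
  case empty
  hence "X \<subseteq> {1}"
    by (auto simp: prime_factorization_empty_iff)
  hence "sum f X \<le> sum f {1}"
    by (intro sum_mono2) (auto simp: f)
  thus ?case by (simp add: f del: One_nat_def)
next
  case (insert p P X)
  have p: "prime p" using insert.prems by auto
  define g where "g = (\<lambda>x. x div p ^ multiplicity p x)"
  define J where "J = Max (multiplicity p ` X)"
  let ?Y = "g ` X"
  have dec: "x = p ^ multiplicity p x * g x" for x
    by (simp add: g_def multiplicity_dvd)
  have fpow: "f (p ^ j) = f p ^ j" for j
    by (induction j) (auto simp: f simp del: One_nat_def)
  have fp: "0 \<le> f p" "f p < 1" using insert.prems f by auto
  have "sum f ?Y \<le> (\<Prod>p\<in>P. 1 / (1 - f p))"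
  proof (rule insert.IH)
    fix y assume "y \<in> ?Y"
    then obtain x where x: "x \<in> X" "y = g x" by auto
    have x0: "0 < x" "prime_factors x \<subseteq> insert p P" using insert.prems(4)[OF x(1)] by auto
    have y0: "0 < y" using dec[of x] x0 x(2) by (auto intro!: Nat.gr0I)
    have "\<not> p dvd y"
      unfolding x(2) g_def using x0 p
      by (intro multiplicity_decompose) (auto simp: prime_gt_Suc_0_nat)
    moreover have "prime_factors y \<subseteq> prime_factors x"
    proof (rule dvd_prime_factors)
      show "y dvd x" using dec[of x] x(2) by (metis dvd_triv_right)
    qed (use x0 in auto)
    ultimately show "0 < y \<and> prime_factors y \<subseteq> P"
      using y0 x0 by (auto simp: prime_factors_dvd)
  qed (use insert.prems in auto)
  \<comment> \<open>The pair of exponent and cofactor determines \<open>x\<close>, so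
    \<open>X\<close> embeds into a finite rectangle on which the sum factorizes.\<close>
  have "sum f X \<le> (\<Sum>(j, y)\<in>{..J} \<times> ?Y. f p ^ j * f y)"
  proof -
    have "sum f X = (\<Sum>x\<in>X. case (multiplicity p x, g x) of (j, y) \<Rightarrow> f p ^ j * f y)"
      using dec f(1) fpow by (intro sum.cong) (simp_all, metis)
    also have "\<dots> = sum (\<lambda>(j, y). f p ^ j * f y) ((\<lambda>x. (multiplicity p x, g x)) ` X)"
      by (subst sum.reindex) (auto simp: inj_on_def intro: trans[OF dec trans[OF _ dec[symmetric]]])
    also have "\<dots> \<le> (\<Sum>(j, y)\<in>{..J} \<times> ?Y. f p ^ j * f y)"
      using insert.prems fp f(3) by (intro sum_mono2) (auto simp: J_def)
    finally show ?thesis .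
  qed
  also have "\<dots> = (\<Sum>j\<le>J. f p ^ j) * sum f ?Y"
    by (simp add: sum_product sum.cartesian_product)
  also have "\<dots> \<le> 1 / (1 - f p) * (\<Prod>p\<in>P. 1 / (1 - f p))"
  proof (rule mult_mono)
    have "(\<Sum>j\<le>J. f p ^ j) = (1 - f p ^ Suc J) / (1 - f p)"
      using fp by (subst sum_gp0) auto
    also have "\<dots> \<le> 1 / (1 - f p)" using fp by (intro divide_right_mono) auto
    finally show "(\<Sum>j\<le>J. f p ^ j) \<le> 1 / (1 - f p)" .
  qed (use fp \<open>sum f ?Y \<le> _\<close> f in \<open>auto intro!: sum_nonneg\<close>)
  also have "\<dots> = (\<Prod>p\<in>insert p P. 1 / (1 - f p))"
    using insert.hyps by simp
  finally show ?case .
qed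

lemma sum_inverse_le_ln:
  assumes "1 \<le> n"
  shows "(\<Sum>j = 2..n. 1 / real j) \<le> ln (real n)"
  using assms
proof (induction n rule: dec_induct)
  case base
  then show ?case by simp
next
  case (step n)
  have "ln (real n / real (Suc n)) \<le> real n / real (Suc n) - 1"
    using step by (intro ln_le_minus_one) auto
  also have "\<dots> = - 1 / real (Suc n)" by (simp add: field_simps)
  finally have "1 / real (Suc n) \<le> ln (real (Suc n)) - ln (real n)"
    using step by (simp add: ln_div)
  thus ?case using step by simp
qed

text \<open>Divisors of \<open>fact z\<close> have only prime factors up to \<open>z\<close>, so an
  Euler product applies. Its logarithm is at most 36 times the sum of \<open>1 / p\<close> over
  primes \<open>p \<le> z\<close>, which is at most \<open>ln z\<close>.\<close>

lemma sum_dvd_fact_powr_le: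
  fixes z :: nat
  assumes z: "4 \<le> ln (real z)"
  shows "(\<Sum>q | q dvd fact z. real q powr (2 / ln (real z) - 1)) \<le> real z ^ 36"
proof -
  define l where "l = ln (real z)"
  define f where "f = (\<lambda>q::nat. real q powr (2 / l - 1))"
  define P where "P = {p. prime p \<and> p \<le> z}"
  have l: "4 \<le> l" using z by (simp add: l_def)
  have z0: "1 < real z" using z by (intro ln_gt_zero_imp_gt_one) (auto intro!: Nat.gr0I)
  have expo: "2 / l - 1 \<le> - (1 / 2)" using l by (simp add: field_simps)
  have fin: "finite P" unfolding P_def by simp
  have f34: "f p \<le> 3 / 4" if "p \<in> P" for p
  proof -
    have p2: "2 \<le> real p" using that prime_ge_2_nat[of p] by (auto simp: P_def)
    have "f p \<le> real p powr (- (1 / 2))" unfolding f_def using p2 expo by (intro powr_mono) auto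
    also have "\<dots> \<le> 2 powr (- (1 / 2))" using p2 by (intro powr_mono2') auto
    also have "\<dots> = 1 / sqrt 2" by (simp add: powr_minus powr_half_sqrt field_simps)
    also have "\<dots> \<le> 3 / 4"
      using real_le_rsqrt[of "4 / 3" 2] by (simp add: field_simps power2_eq_square)
    finally show ?thesis .
  qed
  \<comment> \<open>For \<open>p \<le> z\<close> the factor \<open>p powr (2 / l)\<close> is at most
    \<open>exp 2\<close>. The exponent 36 is this 9 times the 4 in
    \<open>1 / (1 - f p) \<le> 1 + 4 * f p\<close>, valid as \<open>f p \<le> 3 / 4\<close>.\<close>
  have f9: "f p \<le> 9 / real p" if "p \<in> P" for p
  proof -
    have p: "2 \<le> real p" "p \<le> z" using that prime_ge_2_nat[of p] by (auto simp: P_def)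
    have "f p = real p powr (2 / l) / real p"
      using p by (simp add: f_def powr_diff)
    also have "real p powr (2 / l) = exp (2 * ln (real p) / l)"
      using p by (simp add: powr_def)
    also have "exp (2 * ln (real p) / l) \<le> exp 2"
      using p l z0 by (simp add: l_def field_simps)
    also have "exp (2::real) \<le> 3 ^ 2"
      using exp_le power_mono[of "exp 1 :: real" 3 2] by (simp flip: exp_double)
    finally show ?thesis using p by (simp add: divide_right_mono)
  qed
  have "(\<Sum>q | q dvd fact z. f q) \<le> (\<Prod>p\<in>P. 1 / (1 - f p))"
  proof (rule sum_smooth_le_prod)
    show "f (a * b) = f a * f b" for a b by (simp add: f_def powr_mult)
    show "f p < 1" if "p \<in> P" for p using f34[OF that] by simp
    show "0 < x \<and> prime_factors x \<subseteq> P" if "x \<in> {q. q dvd fact z}" for x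
    proof
      show "0 < x" using that by (auto intro!: Nat.gr0I)
      show "prime_factors x \<subseteq> P"
      proof
        fix p assume "p \<in> prime_factors x"
        hence "prime p" "p dvd fact z" using that by (auto simp: prime_factors_dvd intro: dvd_trans)
        thus "p \<in> P" by (simp add: P_def prime_dvd_fact_iff)
      qed
    qed
  qed (use fin in \<open>auto simp: f_def P_def\<close>)
  also have "\<dots> \<le> (\<Prod>p\<in>P. exp (36 / real p))"
  proof (intro prod_mono conjI)
    fix p assume p: "p \<in> P"
    note f34[OF p]
    moreover have "0 \<le> f p" by (simp add: f_def)
    ultimately have "1 / (1 - f p) \<le> 1 + 4 * f p"
      using mult_left_mono[of "f p" "3/4" "f p"]
      by (simp add: field_simps power2_eq_square)
    also have "\<dots> \<le> exp (4 * f p)" by (rule exp_ge_add_one_self)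
    also have "\<dots> \<le> exp (36 / real p)" using f9[OF p] by simp
    finally show "1 / (1 - f p) \<le> exp (36 / real p)" .
    show "0 \<le> 1 / (1 - f p)" using f34[OF p] by simp
  qed
  also have "\<dots> = exp (36 * (\<Sum>p\<in>P. 1 / real p))"
    using fin by (simp add: exp_sum sum_distrib_left)
  also have "(\<Sum>p\<in>P. 1 / real p) \<le> (\<Sum>p = 2..z. 1 / real p)"
    by (intro sum_mono2) (auto simp: P_def prime_ge_2_nat)
  also have "\<dots> \<le> l" unfolding l_def using z0 by (intro sum_inverse_le_ln) auto
  also have "exp (36 * l) = real z ^ 36"
    using z0 exp_of_nat_mult[of 36 "ln (real z)"] by (simp add: l_def)
  finally show ?thesis by (simp add: f_def l_def)
qed

section \<open>Downward induction on the divisor of a side\<close>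

text \<open>Apart from a set of relative size at most \<open>z\<close> to the power -2,
  \<open>ln (gcd n (fact z))\<close> is at most a constant times \<open>(ln z) ^ 2\<close>.
  Comparing its sum over the box with \<open>chebyshev_psi z \<ge> z / 6\<close> gives the claim by
  \<open>large\<close>.\<close>

lemma card_box_products_shrink_step:
  fixes z :: nat
  assumes IH: "\<And>N i q. \<lbrakk>\<And>i. i < m \<Longrightarrow> N i \<le> B; i < m; z < q\<rbrakk> \<Longrightarrow>
      real (card (box_products m (N(i := N i div q))))
      \<le> exp (sqrt (ln (real q))) / real q * real (card (box_products m N))"
    and N: "\<And>i. i < m \<Longrightarrow> N i \<le> B" and i: "i < m"
    and z4: "4 \<le> ln (real z)"
    and large: "6 * ((38 * real m + 2) * ln (real z) ^ 2 + 1) \<le> exp (sqrt (ln (real z)))"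
  shows "real (card (box_products m (N(i := N i div z))))
         \<le> exp (sqrt (ln (real z))) / real z * real (card (box_products m N))"
proof -
  define l where "l = ln (real z)"
  define a where "a = real (card (box_products m N))"
  \<comment> \<open>One majorant for all \<open>q\<close>: for \<open>q > z\<close> it is the
    induction hypothesis weakened by a factor \<open>z\<close>, and for \<open>q \<le> z\<close> it
    is at least 1, so the trivial bound suffices.\<close>
  define h where "h = (\<lambda>q::nat. real z * exp (sqrt (ln (real q))) / real q)"
  \<comment> \<open>With Rankin exponent \<open>1 / l\<close>, the factor
    \<open>W powr -(1 / l)\<close> cancels the \<open>z ^ (38 * m)\<close> coming from
    \<open>hsum\<close> and leaves \<open>exp (- 2 * l)\<close>.\<close>
  define W where "W = exp ((38 * real m + 2) * l ^ 2)"
  let ?S = "box_products m N"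
  let ?T = "{n \<in> ?S. W < real (gcd n (fact z))}"
  have l: "4 \<le> l" using z4 by (simp add: l_def)
  have z1: "1 < real z" using z4 by (intro ln_gt_zero_imp_gt_one) (auto intro!: Nat.gr0I)
  have zl: "real z = exp l" using z1 by (simp add: l_def)
  have a0: "0 \<le> a" by (simp add: a_def)
  have h: "real (card (box_products m (N(i := N i div q)))) \<le> h q * real (card (box_products m N))"
    if "\<And>i. i < m \<Longrightarrow> N i \<le> B" "i < m" "0 < q" for N i q
  proof (cases "z < q")
    case True
    have "real (card (box_products m (N(i := N i div q))))
      \<le> exp (sqrt (ln (real q))) / real q * real (card (box_products m N))"
      using that True by (intro IH) auto
    also have "\<dots> \<le> h q * real (card (box_products m N))"
      using z1 that by (intro mult_right_mono) (auto simp: h_def divide_right_mono)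
    finally show ?thesis .
  next
    case False
    have "real (card (box_products m (N(i := N i div q)))) \<le> 1 * real (card (box_products m N))"
      by (auto intro!: card_box_products_mono)
    also have "1 \<le> h q"
    proof -
      have "real q * 1 \<le> real z * exp (sqrt (ln (real q)))"
        using False that by (intro mult_mono) auto
      thus ?thesis using that by (simp add: h_def field_simps)
    qed
    finally show ?thesis by (simp add: mult_right_mono)
  qed
  \<comment> \<open>Here 38 is 36 from \<open>sum_dvd_fact_powr_le\<close> plus 2: one power of
    \<open>z\<close> is in \<open>h\<close>, another pays for the factor
    \<open>exp (sqrt (ln q))\<close>.\<close>
  have hsum: "(\<Sum>q | q dvd fact z. h q * real q powr (1 / l)) \<le> real z ^ 38"
  proof -
    have "(\<Sum>q | q dvd fact z. h q * real q powr (1 / l)) \<le>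
          (\<Sum>q | q dvd fact z. real z ^ 2 * real q powr (2 / l - 1))"
    proof (intro sum_mono)
      fix q :: nat assume "q \<in> {q. q dvd fact z}"
      hence q: "0 < q" by (auto intro!: Nat.gr0I)
      define t where "t = ln (real q)"
      have t0: "0 \<le> t" using q by (simp add: t_def)
      \<comment> \<open>AM-GM for \<open>t / l\<close> and \<open>l\<close>\<close>
      have "0 \<le> (sqrt t - l) ^ 2 + sqrt t ^ 2 + l ^ 2" by simp
      hence "sqrt t * l \<le> t + l ^ 2"
        using t0 l by (simp add: power2_eq_square algebra_simps)
      hence "sqrt t \<le> t / l + l"
        using l by (simp add: field_simps power2_eq_square)
      moreover have "(2 / l - 1) * t = t / l + t / l - t" by (simp add: algebra_simps)
      ultimately have "l + sqrt t - t + t / l \<le> 2 * l + (2 / l - 1) * t" by linarith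
      hence "exp (l + sqrt t - t + t / l) \<le> exp (2 * l + (2 / l - 1) * t)"
        by simp
      moreover have "h q * real q powr (1 / l) = exp (l + sqrt t - t + t / l)"
      proof -
        have "real q = exp t" using q by (simp add: t_def)
        thus ?thesis by (simp add: h_def zl exp_add exp_diff powr_def flip: t_def)
      qed
      moreover have "real z ^ 2 * real q powr (2 / l - 1) = exp (2 * l + (2 / l - 1) * t)"
        using q by (simp add: zl exp_add powr_def t_def exp_double)
      ultimately show "h q * real q powr (1 / l) \<le> real z ^ 2 * real q powr (2 / l - 1)"
        by simp
    qed
    also have "\<dots> = real z ^ 2 * (\<Sum>q | q dvd fact z. real q powr (2 / l - 1))"
      by (simp add: sum_distrib_left)
    also have "\<dots> \<le> real z ^ 2 * real z ^ 36"
      unfolding l_def using z4 by (intro mult_left_mono sum_dvd_fact_powr_le) auto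
    finally show ?thesis by (simp flip: power_add)
  qed
  have "real (card ?T) \<le>
      W powr -(1 / l) * (\<Sum>q | q dvd fact z. h q * real q powr (1 / l)) ^ m * a"
    unfolding a_def using l
    by (intro card_box_products_large_gcd_le[where B = B] h N) (auto simp: h_def W_def)
  also have "\<dots> \<le> W powr -(1 / l) * (real z ^ 38) ^ m * a"
    using hsum a0
    by (intro mult_right_mono mult_left_mono power_mono sum_nonneg) (auto simp: h_def)
  also have "W powr -(1 / l) = exp (- ((38 * real m + 2) * l))"
    using l by (simp add: W_def powr_def power2_eq_square)
  also have "(real z ^ 38) ^ m = exp (38 * real m * l)"
    by (simp add: zl mult_ac flip: exp_of_nat_mult power_mult)
  also have "exp (- ((38 * real m + 2) * l)) * exp (38 * real m * l) = exp (- 2 * l)"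
    by (simp add: algebra_simps flip: exp_add)
  finally have T: "real (card ?T) \<le> exp (- 2 * l) * a" .
  have "(\<Sum>n\<in>?S. ln (real (gcd n (fact z)))) \<le>
        (\<Sum>n\<in>?S. (38 * real m + 2) * l ^ 2 + (if n \<in> ?T then exp (2 * l) else 0))"
  proof (intro sum_mono)
    fix n assume n: "n \<in> ?S"
    have g0: "0 < gcd n (fact z :: nat)" by simp
    show "ln (real (gcd n (fact z))) \<le>
      (38 * real m + 2) * l ^ 2 + (if n \<in> ?T then exp (2 * l) else 0)"
    proof (cases "n \<in> ?T")
      \<comment> \<open>The crude bound \<open>ln (fact z) \<le> z ^ 2 = exp (2 * l)\<close>
        suffices here, since \<open>T\<close> makes this set smaller by the inverse factor.\<close>
      case True
      have "gcd n (fact z) \<le> (fact z :: nat)" by (intro gcd_le2_nat) auto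
      also have "\<dots> \<le> z ^ z" using fact_le_power[of z, where 'a = nat] by simp
      finally have "real (gcd n (fact z)) \<le> real z ^ z"
        by (metis of_nat_le_iff of_nat_power)
      hence "ln (real (gcd n (fact z))) \<le> ln (real z ^ z)"
        using g0 z1 by (subst ln_le_cancel_iff) auto
      also have "\<dots> = real z * l" using z1 by (simp add: ln_realpow l_def)
      also have "\<dots> \<le> real z * real z"
        unfolding l_def using z1 ln_le_minus_one[of "real z"] by (intro mult_left_mono) auto
      also have "\<dots> = exp (2 * l)" by (simp add: zl exp_double power2_eq_square)
      also have "\<dots> \<le> (38 * real m + 2) * l ^ 2 + exp (2 * l)" by simp
      finally show ?thesis using True by simp
    next
      case False
      hence "real (gcd n (fact z)) \<le> W" using n by auto
      hence "ln (real (gcd n (fact z))) \<le> ln W"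
        using g0 by (subst ln_le_cancel_iff) (auto simp: W_def)
      also have "\<dots> = (38 * real m + 2) * l ^ 2" by (simp add: W_def)
      finally show ?thesis using False by (simp only: if_False add_0_right)
    qed
  qed
  also have "\<dots> = (38 * real m + 2) * l ^ 2 * a + exp (2 * l) * real (card ?T)"
  proof -
    have "(\<Sum>n\<in>?S. if n \<in> ?T then exp (2 * l) else 0) = (\<Sum>n\<in>?T. exp (2 * l))"
      by (intro sum.mono_neutral_cong_right) auto
    thus ?thesis by (simp only: sum.distrib) (simp add: a_def mult.commute)
  qed
  also have "\<dots> \<le> (38 * real m + 2) * l ^ 2 * a + exp (2 * l) * (exp (- 2 * l) * a)"
    by (intro add_left_mono mult_left_mono T) auto
  also have "\<dots> = ((38 * real m + 2) * l ^ 2 + 1) * a"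
    by (simp add: algebra_simps flip: exp_add)
  finally have upper: "(\<Sum>n\<in>?S. ln (real (gcd n (fact z)))) \<le> ((38 * real m + 2) * l ^ 2 + 1) * a" .
  have "real z / 6 * real (card (box_products m (N(i := N i div z)))) \<le>
        chebyshev_psi z * real (card (box_products m (N(i := N i div z))))"
    using z1 by (intro mult_right_mono chebyshev_psi_lower) auto
  also have "\<dots> \<le> (\<Sum>n\<in>?S. ln (real (gcd n (fact z))))"
    by (rule psi_mult_card_box_le[OF i])
  also note upper
  finally have "real z * real (card (box_products m (N(i := N i div z)))) \<le>
        (6 * ((38 * real m + 2) * l ^ 2 + 1)) * a" by (simp add: algebra_simps)
  also have "\<dots> \<le> exp (sqrt l) * a"
    using large a0 by (intro mult_right_mono) (auto simp: l_def)
  finally show ?thesis using z1 by (simp add: field_simps l_def a_def)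
qed

text \<open>The threshold \<open>M\<close> depends on \<open>m\<close> alone. Once \<open>z\<close>
  exceeds every side the shrunken box has a zero side and no products, which starts the downward
  induction.\<close>

lemma card_box_products_shrink:
  "\<exists>M. \<forall>z\<ge>M. \<forall>N. \<forall>i<m. real (card (box_products m (N(i := N i div z))))
         \<le> exp (sqrt (ln (real z))) / real z * real (card (box_products m N))"
proof -
  have "eventually (\<lambda>z::nat. 4 \<le> ln (real z)) at_top" by real_asymp
  moreover have "eventually (\<lambda>z::nat.
      6 * ((38 * real m + 2) * ln (real z) ^ 2 + 1) \<le> exp (sqrt (ln (real z)))) at_top"
    by real_asymp
  ultimately have "eventually (\<lambda>z::nat. 4 \<le> ln (real z) \<and>
      6 * ((38 * real m + 2) * ln (real z) ^ 2 + 1) \<le> exp (sqrt (ln (real z)))) at_top"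
    by (rule eventually_conj)
  then obtain M where M: "\<And>z. z \<ge> M \<Longrightarrow> 4 \<le> ln (real z)"
    "\<And>z. z \<ge> M \<Longrightarrow> 6 * ((38 * real m + 2) * ln (real z) ^ 2 + 1) \<le> exp (sqrt (ln (real z)))"
    unfolding eventually_at_top_linorder by blast
  show ?thesis
  proof (intro exI[of _ M] allI impI)
    fix z i :: nat and N :: "nat \<Rightarrow> nat" assume z: "M \<le> z" and i: "i < m"
    \<comment> \<open>\<open>B\<close> bounds every side and stays fixed while the box varies,
      because the step uses the hypothesis for divided boxes too. The measure
      \<open>Suc B - z\<close> falls as \<open>z\<close> grows.\<close>
    define B where "B = (\<Sum>i<m. N i)"
    have "\<forall>N. (\<forall>i<m. N i \<le> B) \<longrightarrow> (\<forall>i<m. real (card (box_products m (N(i := N i div z))))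
         \<le> exp (sqrt (ln (real z))) / real z * real (card (box_products m N)))"
      using z
    proof (induction "Suc B - z" arbitrary: z rule: less_induct)
      case less
      show ?case
      proof (cases "B < z")
        case True
        have "box_products m (N(i := N i div z)) = {}" if "\<forall>i<m. N i \<le> B" "i < m" for N i
        proof -
          have "N i div z = 0" using that True by (intro div_less) (auto intro: le_less_trans)
          thus ?thesis using that(2) by (force elim!: box_productsE)
        qed
        thus ?thesis by simp
      next
        case False
        have "real (card (box_products m (N(i := N i div z))))
          \<le> exp (sqrt (ln (real z))) / real z * real (card (box_products m N))"
          if "\<forall>i<m. N i \<le> B" "i < m" for N i
        proof (rule card_box_products_shrink_step)
          fix N i q assume "\<And>i. i < m \<Longrightarrow> N i \<le> B" "i < m" "z < q"
          show "real (card (box_products m (N(i := N i div q))))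
            \<le> exp (sqrt (ln (real q))) / real q * real (card (box_products m N))"
          proof -
            have "Suc B - q < Suc B - z" "M \<le> q" using \<open>z < q\<close> False less.prems by auto
            from less.hyps[OF this] show ?thesis using \<open>\<And>i. i < m \<Longrightarrow> N i \<le> B\<close> \<open>i < m\<close> by blast
          qed
        qed (use that M less.prems in auto)
        thus ?thesis by blast
      qed
    qed
    moreover have "\<forall>i<m. N i \<le> B"
      unfolding B_def by (auto intro!: member_le_sum)
    ultimately show "real (card (box_products m (N(i := N i div z))))
         \<le> exp (sqrt (ln (real z))) / real z * real (card (box_products m N))"
      using i by blast
  qed
qed

section \<open>Lengthening the longest side\<close>

text \<open>Write \<open>F (y div q)\<close> as a telescoping sum over \<open>j * q \<le> y\<close>
  and exchange the sums. The common limit \<open>M\<close> makes the results for two values of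
  \<open>y\<close> comparable term by term.\<close>

lemma sum_mangoldt_hyperbola:
  fixes F :: "nat \<Rightarrow> real"
  assumes F0: "F 0 = 0" and M: "y \<le> M"
  shows "(\<Sum>q = 1..y. mangoldt q * F (y div q)) =
         (\<Sum>j = 1..M. (F j - F (j - 1)) * chebyshev_psi (y div j))"
proof -
  have F: "F n = (\<Sum>j = 1..n. F j - F (j - 1))" for n
    using F0 by (induction n) auto
  have le_div: "j \<le> y div q \<longleftrightarrow> j * q \<le> y" if "0 < q" for j q
    using that by (simp add: less_eq_div_iff_mult_less_eq)
  have le_M: "j \<le> M" if "0 < q" "j * q \<le> y" for j q :: nat
  proof -
    have "j * 1 \<le> j * q" using that by (intro mult_left_mono) auto
    thus ?thesis using that M by linarith
  qed
  have "(\<Sum>q = 1..y. mangoldt q * F (y div q)) =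
      (\<Sum>q = 1..M. \<Sum>j = 1..M. if j * q \<le> y then mangoldt q * (F j - F (j - 1)) else 0)"
  proof (rule sum.mono_neutral_cong_left)
    show "mangoldt q * F (y div q) =
      (\<Sum>j = 1..M. if j * q \<le> y then mangoldt q * (F j - F (j - 1)) else 0)"
      if "q \<in> {1..y}" for q
      unfolding F[of "y div q"] sum_distrib_left using that le_div[of q] le_M[of q]
      by (intro sum.mono_neutral_cong_left) auto
    show "\<forall>q\<in>{1..M} - {1..y}.
      (\<Sum>j = 1..M. if j * q \<le> y then mangoldt q * (F j - F (j - 1)) else 0) = 0"
    proof
      fix q assume q: "q \<in> {1..M} - {1..y}"
      have "\<not> j * q \<le> y" if "j \<in> {1..M}" for j
      proof -
        have "1 * q \<le> j * q" using that by (intro mult_right_mono) auto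
        moreover have "y < q" using q by auto
        ultimately show ?thesis by linarith
      qed
      thus "(\<Sum>j = 1..M. if j * q \<le> y then mangoldt q * (F j - F (j - 1)) else 0) = 0"
        by (intro sum.neutral) auto
    qed
  qed (use M in auto)
  also have "\<dots> =
      (\<Sum>j = 1..M. \<Sum>q = 1..M. if j * q \<le> y then mangoldt q * (F j - F (j - 1)) else 0)"
    by (rule sum.swap)
  also have "\<dots> = (\<Sum>j = 1..M. (F j - F (j - 1)) * chebyshev_psi (y div j))"
  proof (intro sum.cong refl)
    fix j assume j: "j \<in> {1..M}"
    show "(\<Sum>q = 1..M. if j * q \<le> y then mangoldt q * (F j - F (j - 1)) else 0) =
          (F j - F (j - 1)) * chebyshev_psi (y div j)"
      unfolding chebyshev_psi_def sum_distrib_left using j le_div[of j] le_M[of j]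
      by (intro sum.mono_neutral_cong_right) (auto simp: mult.commute)
  qed
  finally show ?thesis .
qed

lemma chebyshev_psi_dilate:
  assumes "0 < j"
  shows "chebyshev_psi (c * y div j) \<le> 24 * real c * chebyshev_psi (y div j) + 8 * real c"
proof -
  have lower: "real (y div j) \<le> 6 * chebyshev_psi (y div j) + 1"
    using chebyshev_psi_lower[of "y div j"] chebyshev_psi_nonneg[of "y div j"]
    by (cases "2 \<le> y div j") auto
  have "y \<le> (y div j + 1) * j"
    using dividend_less_div_times[OF assms, of y] by (simp add: algebra_simps)
  hence "c * y \<le> (c * (y div j + 1)) * j"
    using mult_left_mono[of y "(y div j + 1) * j" c] by (simp only: mult.assoc)
  hence "c * y div j \<le> (c * (y div j + 1)) * j div j" by (rule div_le_mono)
  hence le: "c * y div j \<le> c * (y div j + 1)" using assms by simp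
  have "chebyshev_psi (c * y div j) \<le> 4 * real (c * y div j)" by (rule chebyshev_psi_upper)
  also have "\<dots> \<le> 4 * real (c * (y div j + 1))" using le by (intro mult_left_mono of_nat_mono) auto
  also have "\<dots> = 4 * real c * (real (y div j) + 1)" by (simp add: algebra_simps)
  also have "\<dots> \<le> 4 * real c * (6 * chebyshev_psi (y div j) + 1 + 1)"
    using lower by (intro mult_left_mono add_right_mono) auto
  finally show ?thesis by (simp add: algebra_simps)
qed

text \<open>A product outside the smaller box has last factor \<open>n k > N k\<close>, and
  \<open>ln (n k) = (\<Sum>q | q dvd n k. mangoldt q)\<close>.\<close>
lemma card_box_products_diff_ln_le:
  fixes N :: "nat \<Rightarrow> nat"
  assumes "1 \<le> N k" "N k \<le> M"
  shows "(real (card (box_products (Suc k) (N(k := M)))) - real (card (box_products (Suc k) N)))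
           * ln (real (N k))
         \<le> (\<Sum>q = 1..M. mangoldt q * real (card (box_products (Suc k) (N(k := M div q)))))"
proof -
  let ?S = "box_products (Suc k) N" and ?S' = "box_products (Suc k) (N(k := M))"
  let ?E = "\<lambda>q. (*) q ` box_products (Suc k) (N(k := M div q))"
  have sub: "?S \<subseteq> ?S'" using assms by (intro box_products_mono) auto
  have "real (card ?S') - real (card ?S) = real (card (?S' - ?S))"
    using sub by (simp add: card_Diff_subset card_mono of_nat_diff)
  hence "(real (card ?S') - real (card ?S)) * ln (real (N k)) =
         (\<Sum>n\<in>?S' - ?S. ln (real (N k)))" by simp
  \<comment> \<open>Every divisor \<open>q\<close> of the last factor exhibits the product as an
    element of \<open>?E q\<close>, so the weights over these \<open>q\<close> already reach
    \<open>ln (N k)\<close>.\<close>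
  also have "\<dots> \<le> (\<Sum>n\<in>?S' - ?S. \<Sum>q = 1..M. if n \<in> ?E q then mangoldt q else 0)"
  proof (intro sum_mono)
    fix x assume x: "x \<in> ?S' - ?S"
    then obtain n where n: "x = (\<Prod>i<Suc k. n i)" "\<And>i. i < Suc k \<Longrightarrow> 1 \<le> n i"
      "\<And>i. i < Suc k \<Longrightarrow> n i \<le> (N(k := M)) i" by (blast elim!: box_productsE)
    have nk: "N k < n k"
    proof (rule ccontr)
      assume "\<not> N k < n k"
      hence "n i \<le> N i" if "i < Suc k" for i using n(3)[OF that] by (cases "i = k") auto
      hence "x \<in> ?S" using n(1,2) by (intro box_productsI) auto
      thus False using x by simp
    qed
    have nM: "n k \<le> M" using n(3)[of k] by simp
    have "ln (real (N k)) \<le> ln (real (n k))"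
      using assms nk by (subst ln_le_cancel_iff) auto
    also have "\<dots> = (\<Sum>q | q dvd n k. mangoldt q)"
      using nk by (subst mangoldt_sum) auto
    also have "\<dots> = (\<Sum>q | q dvd n k. if x \<in> ?E q then mangoldt q else 0)"
    proof (intro sum.cong refl)
      fix q assume "q \<in> {q. q dvd n k}"
      hence q: "q dvd n k" by simp
      have "x = q * (\<Prod>i<Suc k. (n(k := n k div q)) i)"
        using q by (simp add: n(1))
      moreover have "(\<Prod>i<Suc k. (n(k := n k div q)) i) \<in> box_products (Suc k) (N(k := M div q))"
      proof (rule box_productsI[OF refl])
        fix i assume i: "i < Suc k"
        show "1 \<le> (n(k := n k div q)) i \<and> (n(k := n k div q)) i \<le> (N(k := M div q)) i"
        proof (cases "i = k")
          case True
          have "0 < n k div q" using q nk by (auto simp: dvd_div_eq_0_iff intro!: Nat.gr0I)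
          thus ?thesis using True nM by (auto intro: div_le_mono)
        next
          case False
          thus ?thesis using n(2,3)[OF i] by simp
        qed
      qed
      ultimately have "x \<in> ?E q" by blast
      thus "mangoldt q = (if x \<in> ?E q then mangoldt q else 0)" by simp
    qed
    also have "\<dots> \<le> (\<Sum>q = 1..M. if x \<in> ?E q then mangoldt q else 0)"
    proof (intro sum_mono2)
      show "{q. q dvd n k} \<subseteq> {1..M}"
      proof
        fix q assume "q \<in> {q. q dvd n k}"
        hence "0 < q" "q \<le> n k" using nk dvd_pos_nat[of "n k" q] by (auto intro: dvd_imp_le)
        thus "q \<in> {1..M}" using nM by auto
      qed
    qed (auto simp: mangoldt_nonneg)
    finally show "ln (real (N k)) \<le> (\<Sum>q = 1..M. if x \<in> ?E q then mangoldt q else 0)" .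
  qed
  also have "\<dots> = (\<Sum>q = 1..M. \<Sum>n\<in>?S' - ?S. if n \<in> ?E q then mangoldt q else 0)"
    by (rule sum.swap)
  also have "\<dots> \<le> (\<Sum>q = 1..M. mangoldt q * real (card (box_products (Suc k) (N(k := M div q)))))"
  proof (intro sum_mono)
    fix q assume "q \<in> {1..M}"
    have "(\<Sum>n\<in>?S' - ?S. if n \<in> ?E q then mangoldt q else 0) =
          mangoldt q * real (card {n \<in> ?S' - ?S. n \<in> ?E q})"
      by (simp add: sum.inter_filter[symmetric] mult.commute)
    also have "\<dots> \<le> mangoldt q * real (card (box_products (Suc k) (N(k := M div q))))"
    proof (intro mult_left_mono mangoldt_nonneg of_nat_mono)
      have "card {n \<in> ?S' - ?S. n \<in> ?E q} \<le> card (?E q)"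
        by (intro card_mono) auto
      also have "\<dots> \<le> card (box_products (Suc k) (N(k := M div q)))"
        by (intro card_image_le) auto
      finally show "card {n \<in> ?S' - ?S. n \<in> ?E q} \<le>
        card (box_products (Suc k) (N(k := M div q)))" .
    qed
    finally show "(\<Sum>n\<in>?S' - ?S. if n \<in> ?E q then mangoldt q else 0) \<le>
        mangoldt q * real (card (box_products (Suc k) (N(k := M div q))))" .
  qed
  finally show ?thesis .
qed

text \<open>For large \<open>N k\<close> the weighted count of new products is compared with that of
  the original box by Abel summation. For bounded \<open>N k\<close> all counts are bounded.\<close>

lemma card_box_products_dilate:
  fixes k c :: nat
  assumes c: "1 \<le> c"
  shows "\<exists>C>0. \<forall>N :: nat \<Rightarrow> nat. (\<forall>i\<le>k. 1 \<le> N i \<and> N i \<le> N k) \<longrightarrow>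
    real (card (box_products (Suc k) (N(k := c * N k)))) \<le> C * real (card (box_products (Suc k) N))"
proof -
  define C1 where "C1 = 48 * real c * real (Suc k) + 2"
  define C2 where "C2 = (real c * exp (16 * real c)) ^ Suc k"
  have C: "0 < C1" "0 < C2" using c by (auto simp: C1_def C2_def intro!: add_nonneg_pos)
  have "real (card (box_products (Suc k) (N(k := c * N k))))
        \<le> (C1 + C2) * real (card (box_products (Suc k) N))"
    if N: "\<And>i. i \<le> k \<Longrightarrow> 1 \<le> N i \<and> N i \<le> N k" for N
  proof -
    define y M where "y = N k" and "M = c * y"
    \<comment> \<open>Only the last side varies: \<open>F y\<close> counts the original box and
      \<open>F M\<close> the lengthened one.\<close>
    define F where "F = (\<lambda>t. real (card (box_products (Suc k) (N(k := t)))))"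
    have y: "1 \<le> y" "y \<le> M" using N[of k] c by (auto simp: y_def M_def)
    have Fy: "F y = real (card (box_products (Suc k) N))" by (simp add: F_def y_def)
    have F0: "F 0 = 0"
    proof -
      have "box_products (Suc k) (N(k := 0)) = {}" by (force elim!: box_productsE)
      thus ?thesis by (simp add: F_def)
    qed
    have Fmono: "F s \<le> F t" if "s \<le> t" for s t
      unfolding F_def using that by (intro of_nat_mono card_box_products_mono) auto
    have "1 \<in> box_products (Suc k) N" using N by (intro one_in_box_products) auto
    hence F1: "1 \<le> F y" unfolding Fy by (auto simp: Suc_le_eq card_gt_0_iff)
    have bound: "x \<le> t ^ Suc k" if "x \<in> box_products (Suc k) (N(k := t))" "y \<le> t" for x t
    proof -
      have "x \<le> (\<Prod>i<Suc k. (N(k := t)) i)" using that box_products_bounds by blast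
      also have "\<dots> \<le> (\<Prod>i<Suc k. t)"
      proof (intro prod_mono conjI)
        fix i assume "i \<in> {..<Suc k}"
        thus "(N(k := t)) i \<le> t" using N[of i] that(2) by (auto simp: y_def)
      qed auto
      finally show ?thesis by simp
    qed
    \<comment> \<open>The threshold makes the error \<open>8 * c * F M\<close> at most half of
      \<open>ln y * F M\<close>.\<close>
    show ?thesis
    proof (cases "16 * real c \<le> ln (real y)")
      case True
      have l0: "0 < ln (real y)" using True c by linarith
      have "(F M - F y) * ln (real y) \<le> (\<Sum>q = 1..M. mangoldt q * F (M div q))"
        using card_box_products_diff_ln_le[of N k M] y by (simp add: F_def y_def)
      also have "\<dots> = (\<Sum>j = 1..M. (F j - F (j - 1)) * chebyshev_psi (c * y div j))"
        using F0 by (subst sum_mangoldt_hyperbola[where M = M]) (auto simp: M_def)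
      also have "\<dots> \<le> (\<Sum>j = 1..M. (F j - F (j - 1)) *
          (24 * real c * chebyshev_psi (y div j) + 8 * real c))"
        by (intro sum_mono mult_left_mono chebyshev_psi_dilate) (auto intro!: Fmono)
      also have "\<dots> = 24 * real c * (\<Sum>j = 1..M. (F j - F (j - 1)) * chebyshev_psi (y div j)) +
          8 * real c * (\<Sum>j = 1..M. F j - F (j - 1))"
        by (simp add: sum_distrib_left distrib_left sum.distrib mult_ac)
      also have "(\<Sum>j = 1..M. (F j - F (j - 1)) * chebyshev_psi (y div j)) =
          (\<Sum>q = 1..y. mangoldt q * F (y div q))"
        using F0 y by (subst sum_mangoldt_hyperbola[where M = M]) auto
      also have "(\<Sum>j = 1..M. F j - F (j - 1)) = F M"
        using F0 by (induction M) auto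
      \<comment> \<open>As \<open>y\<close> is the longest side, each product is at most
        \<open>y ^ Suc k\<close>, and so is its gcd with \<open>fact y\<close>.\<close>
      also have "(\<Sum>q = 1..y. mangoldt q * F (y div q)) \<le> real (Suc k) * ln (real y) * F y"
      proof -
        have "(\<Sum>q = 1..y. mangoldt q * F (y div q)) \<le>
              (\<Sum>n\<in>box_products (Suc k) N. ln (real (gcd n (fact y))))"
          using sum_mangoldt_card_box_le[of k "Suc k" N y] by (simp add: F_def y_def)
        also have "\<dots> \<le> (\<Sum>n\<in>box_products (Suc k) N. real (Suc k) * ln (real y))"
        proof (intro sum_mono)
          fix n assume n: "n \<in> box_products (Suc k) N"
          have "gcd n (fact y) \<le> n" using box_products_bounds(1)[OF n] by (intro gcd_le1_nat) auto
          also have "n \<le> y ^ Suc k" using n by (intro bound) (auto simp: y_def)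
          finally have "real (gcd n (fact y)) \<le> real y ^ Suc k"
            by (metis of_nat_le_iff of_nat_power)
          hence "ln (real (gcd n (fact y))) \<le> ln (real y ^ Suc k)"
            using y by (subst ln_le_cancel_iff) auto
          also have "\<dots> = real (Suc k) * ln (real y)" using y by (subst ln_realpow) auto
          finally show "ln (real (gcd n (fact y))) \<le> real (Suc k) * ln (real y)" .
        qed
        also have "\<dots> = real (Suc k) * ln (real y) * F y" by (simp add: Fy)
        finally show ?thesis .
      qed
      also have "8 * real c * F M \<le> ln (real y) / 2 * F M"
        using True Fmono[of 0 M] F0 by (intro mult_right_mono) auto
      finally have "(F M - F y) * ln (real y) \<le>
          24 * real c * (real (Suc k) * ln (real y) * F y) + ln (real y) / 2 * F M"
        by (simp add: mult_left_mono)
      \<comment> \<open>Absorbing half of \<open>ln y * F M\<close> on the left doubles the other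
        constants, which gives \<open>C1\<close>.\<close>
      hence "ln (real y) * F M \<le> ln (real y) * (C1 * F y)"
        by (simp add: C1_def algebra_simps)
      hence "F M \<le> C1 * F y" using l0 by simp
      also have "\<dots> \<le> (C1 + C2) * F y" using C F1 by (intro mult_right_mono) auto
      finally show ?thesis by (simp add: Fy F_def M_def y_def)
    next
      case False
      have "real y \<le> exp (16 * real c)"
        using False y
        by (metis exp_le_cancel_iff exp_ln linorder_not_le nle_le of_nat_0_less_iff
            order_less_le_trans zero_less_one)
      hence "real M \<le> real c * exp (16 * real c)" by (simp add: M_def mult_left_mono)
      hence "real M ^ Suc k \<le> C2" unfolding C2_def by (intro power_mono) auto
      moreover have "card (box_products (Suc k) (N(k := M))) \<le> card {1..M ^ Suc k}"
      proof (intro card_mono)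
        show "box_products (Suc k) (N(k := M)) \<subseteq> {1..M ^ Suc k}"
          using bound[of _ M] y box_products_bounds(1) by (auto simp: Suc_le_eq)
      qed auto
      hence "F M \<le> real (M ^ Suc k)" unfolding F_def by (intro of_nat_mono) simp
      ultimately have "F M \<le> C2 * 1" by simp
      also have "\<dots> \<le> (C1 + C2) * F y" using C F1 by (intro mult_mono) auto
      finally show ?thesis by (simp add: Fy F_def M_def y_def)
    qed
  qed
  thus ?thesis using C by (intro exI[of _ "C1 + C2"]) auto
qed

section \<open>Dyadic scaling and rounding of side lengths\<close>

text \<open>Take the least \<open>j\<close> that passes \<open>y / 2\<close>: the doubling before it
  was still at most \<open>y / 2\<close>.\<close>

lemma ex_dyadic_multiple:
  fixes x y :: real
  assumes "0 < x" "x \<le> y"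
  shows "\<exists>j::nat. y / 2 < 2 ^ j * x \<and> 2 ^ j * x \<le> y"
proof -
  let ?P = "\<lambda>j::nat. y / 2 < 2 ^ j * x"
  define j where "j = (LEAST j. ?P j)"
  obtain i where "y / 2 / x < 2 ^ i" using real_arch_pow[of 2 "y / 2 / x"] by auto
  hence "?P i" using assms by (simp add: field_simps)
  hence "?P j" unfolding j_def by (rule LeastI)
  moreover have "2 ^ j * x \<le> y"
  proof (cases j)
    case 0
    thus ?thesis using assms by simp
  next
    case (Suc i)
    hence "\<not> ?P i" unfolding j_def by (intro not_less_Least) simp
    thus ?thesis using Suc by (simp add: field_simps)
  qed
  ultimately show ?thesis by blast
qed

lemma prodA_eq_card_box_products:
  assumes "\<And>i. i < m \<Longrightarrow> 0 \<le> N i"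
  shows "prodA m N = card (box_products m (\<lambda>i. nat \<lfloor>N i\<rfloor>))"
proof -
  have "real n \<le> N i \<longleftrightarrow> n \<le> nat \<lfloor>N i\<rfloor>" if "i < m" for n i
    using assms[OF that] by (simp add: le_nat_iff le_floor_iff)
  thus ?thesis unfolding prodA_def box_products_def by (intro arg_cong[where f = card]) auto
qed

section \<open>Localized factorizations\<close>

text \<open>The set counted by \<open>Hcount\<close> in the theorem, named so that maps into it can
  be studied.\<close>

definition localized_multiples :: "nat \<Rightarrow> (nat \<Rightarrow> real) \<Rightarrow> nat set" where
  "localized_multiples k N = {n. 1 \<le> n \<and> real n \<le> (\<Prod>i\<le>k. N i) \<and>
     (\<exists>d. (\<Prod>i<k. d i) dvd n \<and> (\<forall>i<k. 0 < d i \<and> N i / 2 < real (d i) \<and> real (d i) \<le> N i))}"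

lemma Hcount_eq_card_localized_multiples:
  "Hcount k (\<Prod>i\<le>k. N i) (\<lambda>i. N i / 2) N = card (localized_multiples k N)"
  by (simp add: Hcount_def localized_multiples_def)

lemma finite_localized_multiples: "finite (localized_multiples k N)"
proof (rule finite_subset)
  show "localized_multiples k N \<subseteq> {..nat \<lfloor>\<Prod>i\<le>k. N i\<rfloor>}"
    by (auto simp: localized_multiples_def le_nat_floor)
qed simp

text \<open>Since each \<open>d i\<close> exceeds \<open>N i / 2\<close>, the cofactor
  \<open>e\<close> is at most \<open>2 ^ k * N k\<close>; one more factor 2 absorbs rounding
  \<open>N k\<close> down.\<close>

lemma localized_multiples_subset_box_products:
  assumes N: "\<And>i. i \<le> k \<Longrightarrow> 1 \<le> N i"
  shows "localized_multiples k N \<subseteq>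
    box_products (Suc k) ((\<lambda>i. nat \<lfloor>N i\<rfloor>)(k := 2 ^ Suc k * nat \<lfloor>N k\<rfloor>))"
proof
  fix n assume "n \<in> localized_multiples k N"
  then obtain d where n: "1 \<le> n" "real n \<le> (\<Prod>i\<le>k. N i)" "(\<Prod>i<k. d i) dvd n"
    and d: "\<And>i. i < k \<Longrightarrow> 0 < d i" "\<And>i. i < k \<Longrightarrow> N i / 2 < real (d i)"
      "\<And>i. i < k \<Longrightarrow> real (d i) \<le> N i"
    unfolding localized_multiples_def by blast
  from n(3) obtain e where e: "n = (\<Prod>i<k. d i) * e" by (elim dvdE)
  have e0: "0 < e" using n(1) e by (auto intro!: Nat.gr0I)
  have Npos: "0 < (\<Prod>i<k. N i)" using N by (intro prod_pos) (force intro: less_le_trans[of 0 1])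
  have "(\<Prod>i<k. N i) / 2 ^ k = (\<Prod>i<k. N i / 2)" by (simp add: prod_dividef)
  also have "\<dots> \<le> (\<Prod>i<k. real (d i))"
    using d(2) N by (intro prod_mono) (force intro: order_trans[of 0 1])
  finally have "(\<Prod>i<k. N i) / 2 ^ k * real e \<le> (\<Prod>i<k. real (d i)) * real e"
    by (rule mult_right_mono) simp
  also have "\<dots> = real n" by (simp add: e)
  also have "\<dots> \<le> (\<Prod>i<k. N i) * N k" using n(2) by (simp add: lessThan_Suc_atMost[symmetric])
  finally have "(\<Prod>i<k. N i) * real e \<le> (\<Prod>i<k. N i) * (2 ^ k * N k)"
    by (simp add: field_simps)
  hence "real e \<le> 2 ^ k * N k" using Npos by simp
  also have "N k \<le> 2 * real (nat \<lfloor>N k\<rfloor>)"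
  proof -
    have "1 \<le> \<lfloor>N k\<rfloor>" using N[of k] by simp
    moreover from this have "real (nat \<lfloor>N k\<rfloor>) = real_of_int \<lfloor>N k\<rfloor>" by simp
    ultimately show ?thesis by linarith
  qed
  finally have "real e \<le> real (2 ^ Suc k * nat \<lfloor>N k\<rfloor>)" by (simp add: mult_ac)
  hence "e \<le> 2 ^ Suc k * nat \<lfloor>N k\<rfloor>" by (simp only: of_nat_le_iff)
  thus "n \<in> box_products (Suc k) ((\<lambda>i. nat \<lfloor>N i\<rfloor>)(k := 2 ^ Suc k * nat \<lfloor>N k\<rfloor>))"
    using d(1,3) e0
    by (intro box_productsI[where n = "d(k := e)"])
       (auto simp: e less_Suc_eq Suc_le_eq le_nat_floor)
qed

lemma card_dyadic_preimage_le:
  "card {n. n * 2 ^ s \<in> localized_multiples k N} \<le> card (localized_multiples k N)"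
  by (rule card_inj_on_le[where f = "\<lambda>n. n * 2 ^ s"])
     (auto simp: inj_on_def finite_localized_multiples)

text \<open>\<open>j i\<close> is the number of doublings that bring \<open>n i\<close> into \<open>(N i / 2, N i]\<close>.\<close>
lemma box_products_subset_dyadic:
  assumes N: "\<And>i. i \<le> k \<Longrightarrow> 1 \<le> N i"
  defines "N' \<equiv> \<lambda>i. nat \<lfloor>N i\<rfloor>"
  shows "box_products (Suc k) N' \<subseteq> (\<Union>i<Suc k. box_products (Suc k) (N'(i := N' i div 2 ^ R))) \<union>
    (\<Union>j\<in>PiE {..<k} (\<lambda>_. {..<R}). {n. n * 2 ^ (\<Sum>i<k. j i) \<in> localized_multiples k N})"
    (is "_ \<subseteq> ?U \<union> ?V")
proof
  fix x assume "x \<in> box_products (Suc k) N'"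
  then obtain n where n: "x = (\<Prod>i<Suc k. n i)" "\<And>i. i < Suc k \<Longrightarrow> 1 \<le> n i"
    "\<And>i. i < Suc k \<Longrightarrow> n i \<le> N' i" by (blast elim!: box_productsE)
  have nN: "real (n i) \<le> N i" if "i < Suc k" for i
    using n(3)[OF that] N[of i] that by (simp add: N'_def le_nat_iff le_floor_iff)
  show "x \<in> ?U \<union> ?V"
  proof (cases "\<exists>i<Suc k. n i \<le> N' i div 2 ^ R")
    case True
    then obtain i where i: "i < Suc k" "n i \<le> N' i div 2 ^ R" by blast
    hence "x \<in> box_products (Suc k) (N'(i := N' i div 2 ^ R))"
      using n by (intro box_productsI[OF n(1)]) auto
    thus ?thesis using i by blast
  next
    case False
    have "\<exists>j. j < R \<and> N i / 2 < 2 ^ j * real (n i) \<and> 2 ^ j * real (n i) \<le> N i" if i: "i < k" for i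
    proof -
      obtain j where j: "N i / 2 < 2 ^ j * real (n i)" "2 ^ j * real (n i) \<le> N i"
        using ex_dyadic_multiple[of "real (n i)" "N i"] n(2)[of i] nN[of i] i by auto
      have "j < R"
      \<comment> \<open>\<open>R\<close> or more doublings would force
        \<open>n i \<le> N' i div 2 ^ R\<close>, the case already treated.\<close>
      proof (rule ccontr)
        assume "\<not> j < R"
        hence "(2 ^ R :: real) \<le> 2 ^ j" by (intro power_increasing) auto
        hence "2 ^ R * real (n i) \<le> 2 ^ j * real (n i)" by (intro mult_right_mono) auto
        hence "real (n i * 2 ^ R) \<le> N i" using j(2) by (simp add: mult.commute)
        hence "n i * 2 ^ R \<le> N' i" unfolding N'_def by (rule le_nat_floor)
        hence "n i \<le> N' i div 2 ^ R" by (simp add: less_eq_div_iff_mult_less_eq)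
        thus False using False i by auto
      qed
      thus ?thesis using j by blast
    qed
    then obtain j0 where j0: "\<And>i. i < k \<Longrightarrow> j0 i < R"
      "\<And>i. i < k \<Longrightarrow> N i / 2 < 2 ^ j0 i * real (n i)"
      "\<And>i. i < k \<Longrightarrow> 2 ^ j0 i * real (n i) \<le> N i" by metis
    define j where "j = restrict j0 {..<k}"
    have j: "j i = j0 i" if "i < k" for i using that by (simp add: j_def)
    have "j \<in> PiE {..<k} (\<lambda>_. {..<R})" using j0(1) by (auto simp: j_def)
    moreover have "x * 2 ^ (\<Sum>i<k. j i) \<in> localized_multiples k N"
    proof -
      let ?d = "\<lambda>i. 2 ^ j i * n i"
      have eq: "x * 2 ^ (\<Sum>i<k. j i) = (\<Prod>i<k. ?d i) * n k"
        by (simp add: n(1) prod.distrib power_sum mult_ac)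
      have d: "0 < ?d i \<and> N i / 2 < real (?d i) \<and> real (?d i) \<le> N i" if "i < k" for i
        using j0(2,3)[OF that] j[OF that] n(2)[of i] that by simp
      have "real (x * 2 ^ (\<Sum>i<k. j i)) = (\<Prod>i<k. real (?d i)) * real (n k)"
        unfolding eq by simp
      also have "\<dots> \<le> (\<Prod>i<k. N i) * N k"
      proof (rule mult_mono)
        show "(\<Prod>i<k. real (?d i)) \<le> (\<Prod>i<k. N i)" using d by (intro prod_mono) auto
        show "0 \<le> (\<Prod>i<k. N i)" using N by (intro prod_nonneg) (force intro: order_trans[of 0 1])
      qed (use nN[of k] in auto)
      also have "\<dots> = (\<Prod>i\<le>k. N i)" by (simp add: lessThan_Suc_atMost[symmetric])
      finally have "real (x * 2 ^ (\<Sum>i<k. j i)) \<le> (\<Prod>i\<le>k. N i)" .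
      moreover have "1 \<le> x * 2 ^ (\<Sum>i<k. j i)"
        using n(2) unfolding n(1) by (simp add: Suc_le_eq prod_pos)
      ultimately show ?thesis
        unfolding localized_multiples_def using eq d by (auto intro!: exI[of _ ?d])
    qed
    ultimately show ?thesis by blast
  qed
qed

section \<open>Assembly of the two bounds\<close>

theorem theorem1p1:
  fixes k :: nat
  assumes "k \<ge> 1"
  shows "\<exists>c1 c2 :: real. c1 > 0 \<and> c2 > 0 \<and>
    (\<forall>N :: nat \<Rightarrow> real. 3 \<le> N 0 \<and> (\<forall>i<k. N i \<le> N (Suc i)) \<longrightarrow>
       c1 * real (Hcount k (\<Prod>i\<le>k. N i) (\<lambda>i. N i / 2) N) \<le> real (prodA (Suc k) N) \<and>
       real (prodA (Suc k) N) \<le> c2 * real (Hcount k (\<Prod>i\<le>k. N i) (\<lambda>i. N i / 2) N))"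
proof -
  obtain C where C: "C > 0" "\<And>N. (\<forall>i\<le>k. 1 \<le> N i \<and> N i \<le> N k) \<Longrightarrow>
    real (card (box_products (Suc k) (N(k := 2 ^ Suc k * N k)))) \<le>
    C * real (card (box_products (Suc k) N))"
    using card_box_products_dilate[of "2 ^ Suc k" k] by auto
  obtain M where M: "\<And>z N i. \<lbrakk>M \<le> z; i < Suc k\<rbrakk> \<Longrightarrow>
    real (card (box_products (Suc k) (N(i := N i div z))))
    \<le> exp (sqrt (ln (real z))) / real z * real (card (box_products (Suc k) N))"
    using card_box_products_shrink[of "Suc k"] by blast
  \<comment> \<open>This makes each of the \<open>Suc k\<close> boxes with one side divided by
    \<open>2 ^ R\<close> hold at most a share \<open>1 / (2 * Suc k)\<close> of the products, hence
    together at most half.\<close>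
  have "eventually (\<lambda>z::nat. exp (sqrt (ln (real z))) / real z \<le> 1 / (2 * real (Suc k))) at_top"
    by real_asymp
  then obtain Z where Z: "\<And>z. Z \<le> z \<Longrightarrow>
      exp (sqrt (ln (real z))) / real z \<le> 1 / (2 * real (Suc k))"
    unfolding eventually_at_top_linorder by blast
  define R where "R = M + Z + 1"
  have "R < 2 ^ R" by (rule less_exp)
  hence R: "M \<le> 2 ^ R" "Z \<le> 2 ^ R" by (auto simp: R_def simp del: power_add)
  have main: "1 / C * real (Hcount k (\<Prod>i\<le>k. N i) (\<lambda>i. N i / 2) N) \<le> real (prodA (Suc k) N) \<and>
       real (prodA (Suc k) N) \<le> 2 * real R ^ k * real (Hcount k (\<Prod>i\<le>k. N i) (\<lambda>i. N i / 2) N)"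
    if N0: "3 \<le> N 0" and mono: "\<forall>i<k. N i \<le> N (Suc i)" for N
  proof -
    define N' where "N' = (\<lambda>i. nat \<lfloor>N i\<rfloor>)"
    define H where "H = localized_multiples k N"
    define a where "a = real (card (box_products (Suc k) N'))"
    \<comment> \<open>The ordering yields \<open>N i \<ge> 3\<close> for all \<open>i\<close> and
      makes \<open>N k\<close> the longest side, as the dilation bound requires.\<close>
    have le: "N i \<le> N j" if "i \<le> j" "j \<le> k" for i j
      using that
    proof (induction j rule: dec_induct)
      case (step j)
      thus ?case using mono[rule_format, of j] by simp
    qed simp
    have N3: "3 \<le> N i" if "i \<le> k" for i using le[of 0 i] that N0 by simp
    have N1: "1 \<le> N i" if "i \<le> k" for i using N3[OF that] by simp
    have A: "real (prodA (Suc k) N) = a"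
      unfolding a_def N'_def using N3
      by (subst prodA_eq_card_box_products) (force intro: order_trans[of 0 3])+
    have "real (card H) \<le> real (card (box_products (Suc k) (N'(k := 2 ^ Suc k * N' k))))"
      unfolding H_def N'_def using N1
      by (intro of_nat_mono card_mono localized_multiples_subset_box_products) auto
    also have "\<dots> \<le> C * a"
      unfolding a_def
    proof (intro C(2) allI impI conjI)
      fix i assume i: "i \<le> k"
      show "1 \<le> N' i" using N1[OF i] by (simp add: N'_def le_nat_iff)
      show "N' i \<le> N' k" using le[of i k] i unfolding N'_def by (intro nat_mono floor_mono) auto
    qed
    finally have lower: "1 / C * real (card H) \<le> a" using C(1) by (simp add: field_simps)
    let ?U = "\<lambda>i. box_products (Suc k) (N'(i := N' i div 2 ^ R))"
    let ?V = "\<lambda>j. {n. n * 2 ^ (\<Sum>i<k. j i) \<in> H}"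
    let ?P = "PiE {..<k} (\<lambda>_. {..<R})"
    have finV: "finite (?V j)" for j
      unfolding H_def
      by (rule finite_vimageI[of _ "\<lambda>n. n * 2 ^ (\<Sum>i<k. j i)", unfolded vimage_def])
         (auto simp: finite_localized_multiples inj_on_def)
    have finP: "finite ?P" by (intro finite_PiE) auto
    have "box_products (Suc k) N' \<subseteq> (\<Union>i<Suc k. ?U i) \<union> (\<Union>j\<in>?P. ?V j)"
      unfolding N'_def H_def by (rule box_products_subset_dyadic[OF N1])
    hence "card (box_products (Suc k) N') \<le> card ((\<Union>i<Suc k. ?U i) \<union> (\<Union>j\<in>?P. ?V j))"
      using finV finP by (intro card_mono) auto
    also have "\<dots> \<le> card (\<Union>i<Suc k. ?U i) + card (\<Union>j\<in>?P. ?V j)" by (rule card_Un_le)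
    also have "\<dots> \<le> (\<Sum>i<Suc k. card (?U i)) + (\<Sum>j\<in>?P. card (?V j))"
      using finP by (intro add_mono card_UN_le) auto
    also have "(\<Sum>j\<in>?P. card (?V j)) \<le> (\<Sum>j\<in>?P. card H)"
      unfolding H_def by (intro sum_mono card_dyadic_preimage_le)
    also have "\<dots> = R ^ k * card H" by (simp add: card_PiE)
    finally have "a \<le> real ((\<Sum>i<Suc k. card (?U i)) + R ^ k * card H)"
      unfolding a_def by (simp only: of_nat_le_iff add_le_cancel_left)
    also have "\<dots> = (\<Sum>i<Suc k. real (card (?U i))) + real R ^ k * real (card H)"
      by (simp only: of_nat_add of_nat_sum of_nat_mult of_nat_power)
    also have "(\<Sum>i<Suc k. real (card (?U i))) \<le> (\<Sum>i<Suc k. 1 / (2 * real (Suc k)) * a)"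
    proof (intro sum_mono)
      fix i assume "i \<in> {..<Suc k}"
      hence "real (card (?U i)) \<le> exp (sqrt (ln (real (2 ^ R)))) / real (2 ^ R) * a"
        unfolding a_def by (intro M R) auto
      also have "\<dots> \<le> 1 / (2 * real (Suc k)) * a"
        by (intro mult_right_mono Z R) (auto simp: a_def)
      finally show "real (card (?U i)) \<le> 1 / (2 * real (Suc k)) * a" .
    qed
    also have "\<dots> = a / 2" by (simp add: field_simps del: of_nat_Suc)
    \<comment> \<open>Moving \<open>a / 2\<close> to the left gives the factor 2;
      \<open>R ^ k\<close> is the number of doubling patterns.\<close>
    finally have "a \<le> 2 * real R ^ k * real (card H)" by simp
    thus ?thesis using lower A Hcount_eq_card_localized_multiples[of k N] by (simp add: H_def)
  qed
  have "0 < 1 / C" "0 < 2 * real R ^ k" using C(1) by (auto simp: R_def)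
  with main show ?thesis by blast
qed

end
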